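(* Let $\rho,\kappa,\delta>0$, $0<\alpha<1$ and let $v_0,v_1\in\mathcal S(\mathbb R)$ be real valued. Let $u$ be the solution, with initial data $u(0,\cdot)=v_0$, $u_t(0,\cdot)=v_1$, of the nonlocal wave equation described in the context. Then for all $t>0$ $$\|u(t,\cdot)\|_{L^2(\mathbb R)}\le\|v_0\|_{L^2(\mathbb R)}+\sqrt{2\pi}\,\left\|\widehat{v_1}\,\min\left\{t,\frac1\omega\right\}\right\|_{L^2(\mathbb R)}.$$
   Context: The nonlocal wave equation is $\rho\,u_{tt}(t,x)=-2\kappa\int_{-\delta}^{\delta}\frac{u(t,x)-u(t,x-y)}{|y|^{1+2\alpha}}\,dy$ for $t>0$, $x\in\mathbb R$, the integral being understood in the principal value sense. Its solution with initial data $(v_0,v_1)$ is $$u(t,x)=\int_{\mathbb R}e^{-i\xi x}\left[\widehat{v_0}(\xi)\cos(\omega(\xi)t)+\frac{\widehat{v_1}(\xi)}{\omega(\xi)}\sin(\omega(\xi)t)\right]d\xi,\qquad \omega(\xi)=\left(\frac{2\kappa}{\rho\,\delta^{2\alpha}}\int_{-1}^{1}\frac{1-\cos(\xi\delta z)}{|z|^{1+2\alpha}}\,dz\right)^{1/2},$$ where $\widehat v(\xi):=\frac1{2\pi}\int_{\mathbb R}v(x)e^{ix\xi}\,dx$ and $\sin(\omega t)/\omega$ is understood as $t$ where $\omega=0$. *)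

theory Defs
  imports "HOL-Analysis.Analysis"
begin

definition schwartz :: "(real \<Rightarrow> real) \<Rightarrow> bool" where
  "schwartz v \<longleftrightarrow>
     (\<forall>n. ((deriv ^^ n) v) differentiable_on UNIV) \<and>
     (\<forall>m n. bounded (range (\<lambda>x. x ^ m * (deriv ^^ n) v x)))"

text \<open>The Fourier transform carries the factor \<open>1/(2\<pi>)\<close> and the kernel \<open>e\<^sup>i\<^sup>x\<^sup>\<xi>\<close>, so the inversion
  formula has kernel \<open>e\<^sup>-\<^sup>i\<^sup>x\<^sup>\<xi>\<close> and no constant.\<close>

definition fourier :: "(real \<Rightarrow> real) \<Rightarrow> real \<Rightarrow> complex" where
  "fourier v \<xi> =
     complex_of_real (1 / (2 * pi)) * (LBINT x. complex_of_real (v x) * exp (\<i> * of_real (x * \<xi>)))"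

definition dispersion :: "real \<Rightarrow> real \<Rightarrow> real \<Rightarrow> real \<Rightarrow> real \<Rightarrow> real" where
  "dispersion \<rho> \<kappa> \<delta> \<alpha> \<xi> =
     sqrt (2 * \<kappa> / (\<rho> * \<delta> powr (2 * \<alpha>)) *
           (LBINT z:{-1..1}. (1 - cos (\<xi> * \<delta> * z)) / \<bar>z\<bar> powr (1 + 2 * \<alpha>)))"

text \<open>\<open>sin (\<omega>t) / \<omega>\<close> and \<open>min {t, 1/\<omega>}\<close>, both with value \<open>t\<close> at \<open>\<omega> = 0\<close>. The case distinctions are
  needed because division by zero yields zero in HOL.\<close>

definition sin_quot :: "real \<Rightarrow> real \<Rightarrow> real" where
  "sin_quot t \<omega> = (if \<omega> = 0 then t else sin (\<omega> * t) / \<omega>)"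

definition min_recip :: "real \<Rightarrow> real \<Rightarrow> real" where
  "min_recip t \<omega> = (if \<omega> = 0 then t else min t (1 / \<omega>))"

text \<open>The solution of the nonlocal wave equation
  \<open>\<rho> u\<^sub>t\<^sub>t(t,x) = -2\<kappa> PV \<integral>\<^sub>-\<^sub>\<delta>\<^sup>\<delta> (u(t,x) - u(t,x-y)) / |y|\<^sup>1\<^sup>+\<^sup>2\<^sup>\<alpha> dy\<close>
  with \<open>u(0,x) = v0 x\<close> and \<open>u\<^sub>t(0,x) = v1 x\<close>, given by its Fourier representation. It takes complex
  values by type; for real initial data they are real.\<close>

definition nonlocal_wave_solution ::
  "real \<Rightarrow> real \<Rightarrow> real \<Rightarrow> real \<Rightarrow> (real \<Rightarrow> real) \<Rightarrow> (real \<Rightarrow> real) \<Rightarrow> real \<Rightarrow> real \<Rightarrow> complex" where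
  "nonlocal_wave_solution \<rho> \<kappa> \<delta> \<alpha> v0 v1 t x =
     (LBINT \<xi>. exp (- \<i> * of_real (\<xi> * x)) *
        (fourier v0 \<xi> * of_real (cos (dispersion \<rho> \<kappa> \<delta> \<alpha> \<xi> * t)) +
         fourier v1 \<xi> * of_real (sin_quot t (dispersion \<rho> \<kappa> \<delta> \<alpha> \<xi>))))"

text \<open>\<open>L2_norm\<close> is the norm of \<open>L\<^sup>2(\<real>)\<close> only on functions satisfying \<open>in_L2\<close>: the Bochner integral of
  a non-integrable function is zero. An inequality between norms is therefore to be read together
  with \<open>in_L2\<close> of the functions involved.\<close>

definition in_L2 :: "(real \<Rightarrow> 'a::real_normed_vector) \<Rightarrow> bool" where
  "in_L2 f \<longleftrightarrow> f \<in> borel_measurable lborel \<and> integrable lborel (\<lambda>x. (norm (f x))\<^sup>2)"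

definition L2_norm :: "(real \<Rightarrow> 'a::real_normed_vector) \<Rightarrow> real" where
  "L2_norm f = sqrt (LBINT x. (norm (f x))\<^sup>2)"

end

theory Submission
  imports Defs "HOL-Probability.Probability"
begin

text \<open>
  The solution is the inverse Fourier transform of \<open>g0 + g1\<close>, where \<open>g0\<close> is the transform of \<open>v0\<close>
  multiplied by \<open>cos (\<omega>t)\<close> and \<open>g1\<close> is the transform of \<open>v1\<close> multiplied by \<open>sin (\<omega>t) / \<omega>\<close>. In the
  normalisation at hand Plancherel's theorem reads \<open>\<parallel>u(t)\<parallel> = sqrt (2\<pi>) * \<parallel>g0 + g1\<parallel>\<close> and
  \<open>sqrt (2\<pi>) * \<parallel>fourier v0\<parallel> = \<parallel>v0\<parallel>\<close>. The triangle inequality and the pointwise bounds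
  \<open>|cos (\<omega>t)| \<le> 1\<close> and \<open>|sin (\<omega>t) / \<omega>| \<le> min {t, 1/\<omega>}\<close> (\<open>sin_quot_le_min_recip\<close>) then give the
  estimate. The dispersion relation contributes that \<open>\<omega>\<close> is measurable and nonnegative.

  Each identity is used as an upper bound for the norm of a transform, which is Bessel's inequality
  \<open>\<parallel>fourier_integral g\<parallel> \<le> sqrt (2\<pi>) * \<parallel>g\<parallel>\<close> (\<open>bessel_inequality\<close>). It is proved by inserting a
  Gaussian weight in \<open>\<integral> |fourier_integral g|\<^sup>2\<close>: by Fubini (\<open>multiplication_formula\<close>) and the known
  transform of the Gaussian, the weighted integral is \<open>2\<pi>\<close> times a quadratic form in \<open>g\<close> whose
  kernel is a normal density, and Schur's test (\<open>gaussian_quadratic_form_le\<close>) bounds the form by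
  \<open>\<parallel>g\<parallel>\<^sup>2\<close> whatever the width of the weight. Letting the weight increase to \<open>1\<close> finishes the argument.

  Bessel's inequality needs an integrable \<open>g\<close>. For \<open>g0 + g1\<close> this is \<open>fourier_integrable\<close>,
  obtained from Bessel's inequality for \<open>v\<close> and its derivative.
\<close>

section \<open>The Fourier integral of an integrable function\<close>

definition fourier_integral :: "(real \<Rightarrow> complex) \<Rightarrow> real \<Rightarrow> complex" where
  "fourier_integral g x = (LBINT s. iexp (x * s) * g s)"

lemma measurable_fourier_integral [measurable]:
  assumes [measurable]: "g \<in> borel_measurable borel"
  shows "fourier_integral g \<in> borel_measurable borel"
  unfolding fourier_integral_def by measurable

lemma norm_fourier_integral_le: "norm (fourier_integral g x) \<le> (LBINT s. norm (g s))"
proof -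
  have "norm (fourier_integral g x) \<le> (LBINT s. norm (iexp (x * s) * g s))"
    unfolding fourier_integral_def by (rule integral_norm_bound)
  then show ?thesis by (simp add: norm_mult)
qed

lemma integrable_oscillation:
  assumes "integrable lborel (g :: real \<Rightarrow> complex)"
  shows "integrable lborel (\<lambda>s. iexp (x * s) * g s)"
proof (rule Bochner_Integration.integrable_bound[OF assms])
  have [measurable]: "g \<in> borel_measurable borel" using assms by auto
  show "(\<lambda>s. iexp (x * s) * g s) \<in> borel_measurable lborel" by measurable
qed (simp add: norm_mult)

text \<open>The Fourier integral is self-adjoint for the bilinear pairing, by Fubini. Keeping a real factor
  \<open>c\<close> in the kernel makes the formula apply both to the transform (\<open>c = 1\<close>) and to its
  conjugate (\<open>c = -1\<close>).\<close>

lemma multiplication_formula: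
  fixes a b :: "real \<Rightarrow> complex"
  assumes a: "integrable lborel a" and b: "integrable lborel b"
  shows "(LBINT x. a x * fourier_integral b (c * x)) = (LBINT y. fourier_integral a (c * y) * b y)"
proof -
  have [measurable]: "a \<in> borel_measurable borel" "b \<in> borel_measurable borel"
    using a b by auto
  have "integrable (lborel \<Otimes>\<^sub>M lborel) (\<lambda>(x, y). a x * (iexp (c * x * y) * b y))"
  proof (rule lborel_pair.Fubini_integrable)
    show "integrable lborel (\<lambda>x. LBINT y. norm (case (x, y) of (x, y) \<Rightarrow> a x * (iexp (c * x * y) * b y)))"
      using a by (simp add: norm_mult)
    show "AE x in lborel. integrable lborel (\<lambda>y. case (x, y) of (x, y) \<Rightarrow> a x * (iexp (c * x * y) * b y))"
      unfolding prod.case by (intro AE_I2 integrable_mult_right integrable_oscillation b)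
  qed measurable
  from lborel_pair.Fubini_integral[OF this]
  have "(LBINT x. LBINT y. a x * (iexp (c * x * y) * b y)) = (LBINT y. LBINT x. a x * (iexp (c * x * y) * b y))"
    by simp
  also have "\<dots> = (LBINT y. (LBINT x. iexp (c * y * x) * a x) * b y)"
    unfolding integral_mult_left_zero[symmetric]
    by (intro Bochner_Integration.integral_cong refl) (simp add: mult_ac)
  finally show ?thesis
    unfolding fourier_integral_def by simp
qed

section \<open>The Gaussian regularisation of Bessel's inequality\<close>

lemma gaussian_weight_eq_normal_density:
  "exp (- (\<sigma> * x)\<^sup>2 / 2) = sqrt (2 * pi) * std_normal_density (\<sigma> * x)"
  by (simp add: std_normal_density_def)

lemma integrable_gaussian_weight:
  assumes "\<sigma> > 0"
  shows "integrable lborel (\<lambda>x::real. exp (- (\<sigma> * x)\<^sup>2 / 2))"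
proof -
  have "integrable lborel (\<lambda>x. std_normal_density (0 + \<sigma> * x))"
    using assms by (intro lborel_integrable_real_affine) auto
  then show ?thesis
    unfolding gaussian_weight_eq_normal_density by simp
qed

text \<open>A rescaling of the characteristic function of the standard normal distribution. Since the right
  side is \<open>2\<pi>\<close> times a probability density which concentrates at \<open>0\<close> as \<open>\<sigma> \<rightarrow> 0\<close>, this is where
  the constant \<open>2\<pi>\<close> of Plancherel's theorem comes from.\<close>

lemma fourier_integral_gaussian_weight:
  assumes "\<sigma> > 0"
  shows "fourier_integral (\<lambda>x. of_real (exp (- (\<sigma> * x)\<^sup>2 / 2))) t = of_real (2 * pi * normal_density 0 \<sigma> t)"
proof -
  have "of_real (exp (- ((t / \<sigma>)\<^sup>2) / 2)) = char std_normal_distribution (t / \<sigma>)"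
    by (simp add: char_std_normal_distribution)
  also have "\<dots> = (LBINT y. std_normal_density y *\<^sub>R iexp (t / \<sigma> * y))"
    unfolding char_def by (subst integral_density) auto
  also have "\<dots> = \<sigma> *\<^sub>R (LBINT x. std_normal_density (\<sigma> * x) *\<^sub>R iexp (t * x))"
    using assms by (subst lborel_integral_real_affine[where c = \<sigma> and t = 0]) auto
  finally have "of_real (exp (- ((t / \<sigma>)\<^sup>2) / 2) * (sqrt (2 * pi) / \<sigma>)) =
     sqrt (2 * pi) *\<^sub>R (LBINT x. std_normal_density (\<sigma> * x) *\<^sub>R iexp (t * x))"
    using assms by (simp add: scaleR_conv_of_real field_simps)
  also have "\<dots> = fourier_integral (\<lambda>x. of_real (exp (- (\<sigma> * x)\<^sup>2 / 2))) t"
    unfolding gaussian_weight_eq_normal_density fourier_integral_def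
      integral_scaleR_right[symmetric]
    by (intro Bochner_Integration.integral_cong refl) (simp add: scaleR_conv_of_real mult_ac)
  finally have "fourier_integral (\<lambda>x. of_real (exp (- (\<sigma> * x)\<^sup>2 / 2))) t
      = of_real (exp (- ((t / \<sigma>)\<^sup>2) / 2) * (sqrt (2 * pi) / \<sigma>))" by simp
  also have "exp (- ((t / \<sigma>)\<^sup>2) / 2) * (sqrt (2 * pi) / \<sigma>) = 2 * pi * normal_density 0 \<sigma> t"
    using assms real_sqrt_mult_self[of "2 * pi"]
    by (simp add: normal_density_def real_sqrt_mult power_divide field_simps)
  finally show ?thesis .
qed

lemma nn_integral_normal_density:
  assumes "\<sigma> > 0"
  shows "(\<integral>\<^sup>+x. ennreal (normal_density \<mu> \<sigma> x) \<partial>lborel) = 1"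
  using assms by (subst nn_integral_eq_integral) auto

text \<open>Schur's test for the Gaussian kernel: by \<open>h r * h s \<le> ((h r)\<^sup>2 + (h s)\<^sup>2) / 2\<close> the double integral
  splits into two halves, and in each of them the kernel is integrated out to \<open>1\<close> in one of its
  variables.\<close>

lemma gaussian_quadratic_form_le:
  fixes h :: "real \<Rightarrow> real"
  assumes [measurable]: "h \<in> borel_measurable borel" and nonneg: "\<And>x. h x \<ge> 0" and \<sigma>: "\<sigma> > 0"
  shows "(\<integral>\<^sup>+r. ennreal (h r) * (\<integral>\<^sup>+s. ennreal (normal_density r \<sigma> s * h s) \<partial>lborel) \<partial>lborel)
           \<le> (\<integral>\<^sup>+s. ennreal ((h s)\<^sup>2) \<partial>lborel)" (is "?L \<le> ?I")
proof -
  have [measurable]: "(\<lambda>x. normal_density (fst x) \<sigma> (snd x)) \<in> borel_measurable (borel \<Otimes>\<^sub>M borel)"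
    unfolding normal_density_def by measurable
  have sym: "normal_density r \<sigma> s = normal_density s \<sigma> r" for r s
    by (simp add: normal_density_def power2_commute)
  have amgm: "h r * (normal_density r \<sigma> s * h s)
      \<le> 1/2 * ((h r)\<^sup>2 * normal_density r \<sigma> s) + 1/2 * (normal_density r \<sigma> s * (h s)\<^sup>2)" for r s
    using mult_left_mono[OF sum_squares_bound[of "h r" "h s"] normal_density_nonneg[of r \<sigma> s]]
    by (simp add: algebra_simps)
  have split: "ennreal (c * x + c * y) = ennreal c * ennreal x + ennreal c * ennreal y"
    if "c \<ge> 0" "x \<ge> 0" "y \<ge> 0" for c x y :: real
    using that by (simp add: ennreal_mult')
  have "?L = (\<integral>\<^sup>+r. \<integral>\<^sup>+s. ennreal (h r * (normal_density r \<sigma> s * h s)) \<partial>lborel \<partial>lborel)"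
    by (subst nn_integral_cmult[symmetric]) (auto simp: ennreal_mult' nonneg)
  also have "\<dots> \<le> (\<integral>\<^sup>+r. \<integral>\<^sup>+s. ennreal (1/2) * ennreal ((h r)\<^sup>2 * normal_density r \<sigma> s)
      + ennreal (1/2) * ennreal (normal_density r \<sigma> s * (h s)\<^sup>2) \<partial>lborel \<partial>lborel)"
  proof (intro nn_integral_mono)
    fix r s
    show "ennreal (h r * (normal_density r \<sigma> s * h s))
        \<le> ennreal (1/2) * ennreal ((h r)\<^sup>2 * normal_density r \<sigma> s)
          + ennreal (1/2) * ennreal (normal_density r \<sigma> s * (h s)\<^sup>2)"
      using ennreal_leI[OF amgm[of r s]] by (subst (asm) split) auto
  qed
  also have "\<dots> = ennreal (1/2) * (\<integral>\<^sup>+r. \<integral>\<^sup>+s. ennreal ((h r)\<^sup>2 * normal_density r \<sigma> s) \<partial>lborel \<partial>lborel)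
      + ennreal (1/2) * (\<integral>\<^sup>+r. \<integral>\<^sup>+s. ennreal (normal_density r \<sigma> s * (h s)\<^sup>2) \<partial>lborel \<partial>lborel)"
    by (simp add: nn_integral_add nn_integral_cmult)
  also have "(\<integral>\<^sup>+r. \<integral>\<^sup>+s. ennreal (normal_density r \<sigma> s * (h s)\<^sup>2) \<partial>lborel \<partial>lborel)
      = (\<integral>\<^sup>+s. \<integral>\<^sup>+r. ennreal (normal_density r \<sigma> s * (h s)\<^sup>2) \<partial>lborel \<partial>lborel)"
    unfolding normal_density_def by (rule lborel_pair.Fubini') measurable
  also have "\<dots> = (\<integral>\<^sup>+s. \<integral>\<^sup>+r. ennreal ((h s)\<^sup>2 * normal_density s \<sigma> r) \<partial>lborel \<partial>lborel)"
    by (subst sym) (simp add: mult.commute)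
  also have "(\<integral>\<^sup>+s. \<integral>\<^sup>+r. ennreal ((h s)\<^sup>2 * normal_density s \<sigma> r) \<partial>lborel \<partial>lborel) = ?I"
    using \<sigma> by (simp add: ennreal_mult' nn_integral_cmult nn_integral_normal_density)
  also have "ennreal (1/2) * ?I + ennreal (1/2) * ?I = ?I"
  proof -
    have "ennreal (1/2) + ennreal (1/2) = 1"
      by (subst ennreal_plus[symmetric]) auto
    then show ?thesis by (simp only: distrib_right[symmetric] mult_1)
  qed
  finally show ?thesis .
qed

lemma norm_integral_le_nn_integral:
  fixes f :: "'a \<Rightarrow> 'b :: {banach, second_countable_topology}"
  shows "ennreal (norm (integral\<^sup>L M f)) \<le> (\<integral>\<^sup>+x. ennreal (norm (f x)) \<partial>M)"
  by (cases "integrable M f") (auto simp: integral_norm_bound_ennreal not_integrable_integral_eq)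

text \<open>The transform of an integrable \<open>g\<close> is bounded, so with the weight its square is integrable, and
  the square may be expanded and the integrals exchanged. Integrating over \<open>x\<close> first leaves the quadratic form
  \<open>2\<pi> \<integral>\<integral> cnj (g r) * normal_density r \<sigma> s * g s ds dr\<close>, which is bounded independently of \<open>\<sigma>\<close>.\<close>

lemma weighted_bessel:
  assumes g: "integrable lborel g" and \<sigma>: "\<sigma> > 0"
  shows "(\<integral>\<^sup>+x. ennreal (exp (- (\<sigma> * x)\<^sup>2 / 2) * (norm (fourier_integral g x))\<^sup>2) \<partial>lborel)
           \<le> ennreal (2 * pi) * (\<integral>\<^sup>+s. ennreal ((norm (g s))\<^sup>2) \<partial>lborel)"
proof -
  define w where "w x = exp (- (\<sigma> * x)\<^sup>2 / 2)" for x
  have [measurable]: "g \<in> borel_measurable borel" using g by auto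
  have [measurable]: "w \<in> borel_measurable borel" unfolding w_def by measurable
  have w: "integrable lborel w" 
    unfolding w_def by (rule integrable_gaussian_weight[OF \<sigma>])
  have w_nonneg: "w x \<ge> 0" for x by (simp add: w_def)
  let ?F = "fourier_integral g"
  have wc: "integrable lborel (\<lambda>x. iexp (r * x) * complex_of_real (w x))" for r
    by (intro integrable_oscillation integrable_of_real w)
  have wF: "integrable lborel (\<lambda>x. of_real (w x) * ?F x)"
  proof (rule Bochner_Integration.integrable_bound)
    show "integrable lborel (\<lambda>x. w x * (LBINT s. norm (g s)))" using w by simp
  qed (auto simp: norm_mult w_nonneg abs_mult intro!: mult_mono norm_fourier_integral_le order.trans[OF norm_fourier_integral_le])
  have wF2: "integrable lborel (\<lambda>x. w x * (norm (?F x))\<^sup>2)"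
  proof (rule Bochner_Integration.integrable_bound)
    show "integrable lborel (\<lambda>x. w x * (LBINT s. norm (g s))\<^sup>2)" using w by simp
  qed (auto simp: w_nonneg abs_mult intro!: mult_mono power_mono norm_fourier_integral_le)
  \<comment> \<open>The exponentials of the two transforms combine into a shift of the transformed weight.\<close>
  have inner: "fourier_integral (\<lambda>x. of_real (w x) * ?F x) (- r)
      = (LBINT s. of_real (2 * pi * normal_density r \<sigma> s) * g s)" for r
  proof -
    have "fourier_integral (\<lambda>x. of_real (w x) * ?F x) (- r)
        = (LBINT x. (iexp (- r * x) * of_real (w x)) * fourier_integral g (1 * x))"
      by (simp add: fourier_integral_def mult_ac)
    also have "\<dots> = (LBINT s. fourier_integral (\<lambda>x. iexp (- r * x) * of_real (w x)) (1 * s) * g s)"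
      by (rule multiplication_formula[OF wc g])
    also have "\<dots> = (LBINT s. fourier_integral (\<lambda>x. of_real (w x)) (s - r) * g s)"
      unfolding fourier_integral_def mult.assoc[symmetric] exp_add[symmetric]
      by (simp add: algebra_simps)
    also have "\<dots> = (LBINT s. of_real (2 * pi * normal_density r \<sigma> s) * g s)"
      unfolding w_def by (subst fourier_integral_gaussian_weight[OF \<sigma>]) (simp add: normal_density_def)
    finally show ?thesis .
  qed
  have "complex_of_real (LBINT x. w x * (norm (?F x))\<^sup>2) = (LBINT x. of_real (w x * (norm (?F x))\<^sup>2))"
    by (rule integral_of_real[OF wF2, symmetric])
  also have "\<dots> = (LBINT x. (of_real (w x) * ?F x) * fourier_integral (\<lambda>s. cnj (g s)) (- 1 * x))"
  proof (intro Bochner_Integration.integral_cong refl)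
    fix x
    have "fourier_integral (\<lambda>s. cnj (g s)) (- 1 * x) = cnj (?F x)"
    proof -
      have "fourier_integral (\<lambda>s. cnj (g s)) (- 1 * x) = (LBINT s. cnj (iexp (x * s) * g s))"
        unfolding fourier_integral_def
        by (intro Bochner_Integration.integral_cong refl) (simp add: exp_cnj)
      also have "\<dots> = cnj (?F x)"
        unfolding fourier_integral_def by (rule Bochner_Integration.integral_cnj)
      finally show ?thesis .
    qed
    then show "of_real (w x * (norm (?F x))\<^sup>2) 
        = (of_real (w x) * ?F x) * fourier_integral (\<lambda>s. cnj (g s)) (- 1 * x)"
      by (simp add: complex_norm_square[symmetric] mult.assoc)
  qed
  also have "\<dots> = (LBINT r. fourier_integral (\<lambda>x. of_real (w x) * ?F x) (- 1 * r) * cnj (g r))"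
    using g by (intro multiplication_formula wF) simp
  finally have id: "complex_of_real (LBINT x. w x * (norm (?F x))\<^sup>2)
     = (LBINT r. (LBINT s. of_real (2 * pi * normal_density r \<sigma> s) * g s) * cnj (g r))"
    using inner by simp
  have "(\<integral>\<^sup>+x. ennreal (w x * (norm (?F x))\<^sup>2) \<partial>lborel) = ennreal (LBINT x. w x * (norm (?F x))\<^sup>2)"
    using wF2 by (intro nn_integral_eq_integral) (auto simp: w_nonneg)
  also have "\<dots> \<le> ennreal (norm (complex_of_real (LBINT x. w x * (norm (?F x))\<^sup>2)))"
    by (intro ennreal_leI) simp
  also have "\<dots> \<le> (\<integral>\<^sup>+r. ennreal (norm ((LBINT s. of_real (2 * pi * normal_density r \<sigma> s) * g s) * cnj (g r))) \<partial>lborel)"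
    unfolding id by (rule norm_integral_le_nn_integral)
  also have "\<dots> \<le> (\<integral>\<^sup>+r. ennreal (2 * pi) * (ennreal (norm (g r)) *
      (\<integral>\<^sup>+s. ennreal (normal_density r \<sigma> s * norm (g s)) \<partial>lborel)) \<partial>lborel)"
  proof (intro nn_integral_mono)
    fix r
    have "ennreal (norm (LBINT s. of_real (2 * pi * normal_density r \<sigma> s) * g s))
       \<le> (\<integral>\<^sup>+s. ennreal (norm (of_real (2 * pi * normal_density r \<sigma> s) * g s)) \<partial>lborel)"
      by (rule norm_integral_le_nn_integral)
    also have "\<dots> = (\<integral>\<^sup>+s. ennreal (2 * pi) * ennreal (normal_density r \<sigma> s * norm (g s)) \<partial>lborel)"
      by (simp add: norm_mult abs_mult ennreal_mult'[symmetric] mult.assoc del: of_real_mult)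
    also have "\<dots> = ennreal (2 * pi) * (\<integral>\<^sup>+s. ennreal (normal_density r \<sigma> s * norm (g s)) \<partial>lborel)"
      by (rule nn_integral_cmult) measurable
    finally have le: "ennreal (norm (LBINT s. of_real (2 * pi * normal_density r \<sigma> s) * g s)) \<le> \<dots>" .
    show "ennreal (norm ((LBINT s. of_real (2 * pi * normal_density r \<sigma> s) * g s) * cnj (g r)))
      \<le> ennreal (2 * pi) * (ennreal (norm (g r)) * (\<integral>\<^sup>+s. ennreal (normal_density r \<sigma> s * norm (g s)) \<partial>lborel))"
      using mult_right_mono[OF le, of "ennreal (norm (g r))"]
      by (simp add: norm_mult ennreal_mult' mult_ac)
  qed
  also have "\<dots> = ennreal (2 * pi) * (\<integral>\<^sup>+r. ennreal (norm (g r)) *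
      (\<integral>\<^sup>+s. ennreal (normal_density r \<sigma> s * norm (g s)) \<partial>lborel) \<partial>lborel)"
    unfolding normal_density_def by (rule nn_integral_cmult) measurable
  also have "\<dots> \<le> ennreal (2 * pi) * (\<integral>\<^sup>+s. ennreal ((norm (g s))\<^sup>2) \<partial>lborel)"
    by (intro mult_left_mono gaussian_quadratic_form_le \<sigma>) auto
  finally show ?thesis unfolding w_def .
qed

text \<open>The weights increase to \<open>1\<close> as \<open>\<sigma> \<rightarrow> 0\<close>, so Fatou's lemma removes them. Stated in extended
  nonnegative integrals, so that the transform of a square-integrable
  \<open>g\<close> is seen to be square-integrable at the same time.\<close>

lemma nn_bessel_inequality:
  assumes g: "integrable lborel g"
  shows "(\<integral>\<^sup>+x. ennreal ((norm (fourier_integral g x))\<^sup>2) \<partial>lborel)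
           \<le> ennreal (2 * pi) * (\<integral>\<^sup>+s. ennreal ((norm (g s))\<^sup>2) \<partial>lborel)" (is "_ \<le> ?B")
proof -
  have [measurable]: "g \<in> borel_measurable borel" using g by auto
  define f where "f n x = ennreal (exp (- (1 / Suc n * x)\<^sup>2 / 2) * (norm (fourier_integral g x))\<^sup>2)"
    for n :: nat and x
  have [measurable]: "f n \<in> borel_measurable lborel" for n unfolding f_def by measurable
  have "liminf (\<lambda>n. f n x) = ennreal ((norm (fourier_integral g x))\<^sup>2)" for x
  proof -
    have "(\<lambda>n. exp (- (1 / Suc n * x)\<^sup>2 / 2) * (norm (fourier_integral g x))\<^sup>2)
        \<longlonglongrightarrow> exp (- (0 * x)\<^sup>2 / 2) * (norm (fourier_integral g x))\<^sup>2"
      by (intro tendsto_intros LIMSEQ_Suc[OF lim_1_over_n]) simp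
    then have "(\<lambda>n. f n x) \<longlonglongrightarrow> ennreal ((norm (fourier_integral g x))\<^sup>2)"
      unfolding f_def by (intro tendsto_ennrealI) simp
    then show ?thesis by (intro lim_imp_Liminf) auto
  qed
  then have "(\<integral>\<^sup>+x. ennreal ((norm (fourier_integral g x))\<^sup>2) \<partial>lborel) = (\<integral>\<^sup>+x. liminf (\<lambda>n. f n x) \<partial>lborel)"
    by simp
  also have "\<dots> \<le> liminf (\<lambda>n. \<integral>\<^sup>+x. f n x \<partial>lborel)"
    by (rule nn_integral_liminf) measurable
  also have "\<dots> \<le> liminf (\<lambda>n::nat. ?B)"
    unfolding f_def by (intro Liminf_mono always_eventually allI weighted_bessel[OF g]) simp
  also have "\<dots> = ?B" by (intro lim_imp_Liminf) auto
  finally show ?thesis .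
qed

section \<open>Square-integrable functions\<close>

lemma in_L2_measurable [measurable_dest]:
  "in_L2 f \<Longrightarrow> f \<in> borel_measurable lborel"
  by (simp add: in_L2_def)

lemma L2_norm_nonneg: "L2_norm f \<ge> 0"
  by (simp add: L2_norm_def)

lemma L2_norm_power2: "(L2_norm f)\<^sup>2 = (LBINT x. (norm (f x))\<^sup>2)"
  by (simp add: L2_norm_def)

lemma in_L2_bound:
  assumes "g \<in> borel_measurable lborel" and "B \<ge> 0"
    and "(\<integral>\<^sup>+x. ennreal ((norm (g x))\<^sup>2) \<partial>lborel) \<le> ennreal (B\<^sup>2)"
  shows "in_L2 g" and "L2_norm g \<le> B"
proof -
  have "(\<integral>\<^sup>+x. ennreal ((norm (g x))\<^sup>2) \<partial>lborel) < \<infinity>"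
    using assms(3) by (auto simp: less_top[symmetric] top_unique)
  then have i: "integrable lborel (\<lambda>x. (norm (g x))\<^sup>2)"
    using assms(1) by (intro integrableI_bounded) auto
  then show "in_L2 g" using assms(1) by (simp add: in_L2_def)
  have "ennreal ((L2_norm g)\<^sup>2) \<le> ennreal (B\<^sup>2)"
    using assms(3) i by (simp add: L2_norm_power2 nn_integral_eq_integral)
  then show "L2_norm g \<le> B"
    using \<open>B \<ge> 0\<close> by (intro power2_le_imp_le[OF _ \<open>B \<ge> 0\<close>]) simp
qed

lemma in_L2_nn_integral:
  "in_L2 f \<Longrightarrow> (\<integral>\<^sup>+x. ennreal ((norm (f x))\<^sup>2) \<partial>lborel) = ennreal ((L2_norm f)\<^sup>2)"
  by (simp add: in_L2_def L2_norm_power2 nn_integral_eq_integral)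

lemma L2_norm_mono:
  assumes "in_L2 g" and "f \<in> borel_measurable lborel" and "\<And>x. norm (f x) \<le> norm (g x)"
  shows "in_L2 f" and "L2_norm f \<le> L2_norm g"
proof -
  have "(\<integral>\<^sup>+x. ennreal ((norm (f x))\<^sup>2) \<partial>lborel) \<le> (\<integral>\<^sup>+x. ennreal ((norm (g x))\<^sup>2) \<partial>lborel)"
    using assms(3) by (intro nn_integral_mono ennreal_leI power_mono) auto
  then have "(\<integral>\<^sup>+x. ennreal ((norm (f x))\<^sup>2) \<partial>lborel) \<le> ennreal ((L2_norm g)\<^sup>2)"
    unfolding in_L2_nn_integral[OF assms(1)] .
  from in_L2_bound[OF assms(2) L2_norm_nonneg this]
  show "in_L2 f" and "L2_norm f \<le> L2_norm g" .
qed

lemma L2_norm_cmult: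
  fixes f :: "real \<Rightarrow> complex"
  assumes "in_L2 f"
  shows "in_L2 (\<lambda>x. c * f x)" and "L2_norm (\<lambda>x. c * f x) = norm c * L2_norm f"
  using assms by (auto simp: in_L2_def L2_norm_def norm_mult power_mult_distrib real_sqrt_mult)

text \<open>Minkowski's inequality from the convexity of the square: for \<open>A > \<parallel>f\<parallel>\<close> and \<open>B > \<parallel>g\<parallel>\<close>, the square
  of \<open>f + g = (A + B) * (A / (A + B) * (f / A) + B / (A + B) * (g / B))\<close> is at most
  \<open>(A + B) * (|f|\<^sup>2 / A + |g|\<^sup>2 / B)\<close>, whose integral is at most \<open>(A + B)\<^sup>2\<close>. Strict bounds \<open>A\<close> and
  \<open>B\<close> avoid dividing by a vanishing norm.\<close>

lemma L2_norm_triangle: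
  fixes f g :: "real \<Rightarrow> complex"
  assumes f: "in_L2 f" and g: "in_L2 g"
  shows "in_L2 (\<lambda>x. f x + g x)" and "L2_norm (\<lambda>x. f x + g x) \<le> L2_norm f + L2_norm g"
proof -
  note [measurable] = f[THEN in_L2_measurable] g[THEN in_L2_measurable]
  have *: "in_L2 (\<lambda>x. f x + g x) \<and> L2_norm (\<lambda>x. f x + g x) \<le> A + B"
    if A: "A > L2_norm f" and B: "B > L2_norm g" for A B
  proof -
    have pos: "A > 0" "B > 0"
      using A B L2_norm_nonneg[of f] L2_norm_nonneg[of g] by linarith+
    have convex: "(norm (f x + g x))\<^sup>2 \<le> (A + B) * ((norm (f x))\<^sup>2 / A + (norm (g x))\<^sup>2 / B)" for x
    proof -
      have "(norm (f x + g x))\<^sup>2 \<le> (norm (f x) + norm (g x))\<^sup>2"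
        by (intro power_mono norm_triangle_ineq norm_ge_zero)
      also have "\<dots> \<le> (A + B) * (B * (norm (f x))\<^sup>2 + A * (norm (g x))\<^sup>2) / (A * B)"
      proof -
        have "(A + B) * (B * (norm (f x))\<^sup>2 + A * (norm (g x))\<^sup>2) - A * B * (norm (f x) + norm (g x))\<^sup>2
            = (B * norm (f x) - A * norm (g x))\<^sup>2"
          by (simp add: algebra_simps power2_eq_square)
        then have "A * B * (norm (f x) + norm (g x))\<^sup>2
            \<le> (A + B) * (B * (norm (f x))\<^sup>2 + A * (norm (g x))\<^sup>2)"
          by (metis diff_ge_0_iff_ge zero_le_power2)
        then show ?thesis
          using pos by (simp add: pos_le_divide_eq mult.commute)
      qed
      also have "\<dots> = (A + B) * ((norm (f x))\<^sup>2 / A + (norm (g x))\<^sup>2 / B)"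
        using pos by (simp add: field_simps)
      finally show ?thesis .
    qed
    have i: "integrable lborel (\<lambda>x. (A + B) * ((norm (f x))\<^sup>2 / A + (norm (g x))\<^sup>2 / B))"
      using f g by (simp add: in_L2_def)
    have "(\<integral>\<^sup>+x. ennreal ((norm (f x + g x))\<^sup>2) \<partial>lborel)
        \<le> (\<integral>\<^sup>+x. ennreal ((A + B) * ((norm (f x))\<^sup>2 / A + (norm (g x))\<^sup>2 / B)) \<partial>lborel)"
      by (intro nn_integral_mono ennreal_leI convex)
    also have "\<dots> = ennreal (LBINT x. (A + B) * ((norm (f x))\<^sup>2 / A + (norm (g x))\<^sup>2 / B))"
      using i pos by (intro nn_integral_eq_integral) auto
    also have "(LBINT x. (A + B) * ((norm (f x))\<^sup>2 / A + (norm (g x))\<^sup>2 / B))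
        = (A + B) * ((L2_norm f)\<^sup>2 / A + (L2_norm g)\<^sup>2 / B)"
      using f g by (simp add: in_L2_def L2_norm_power2)
    also have "\<dots> \<le> (A + B) * (A\<^sup>2 / A + B\<^sup>2 / B)"
      using A B pos L2_norm_nonneg
      by (intro mult_left_mono add_mono divide_right_mono power_mono) (auto simp: less_imp_le)
    also have "\<dots> = (A + B)\<^sup>2"
      using pos by (simp add: power2_eq_square)
    finally have "(\<integral>\<^sup>+x. ennreal ((norm (f x + g x))\<^sup>2) \<partial>lborel) \<le> ennreal ((A + B)\<^sup>2)"
      by (simp add: ennreal_leI)
    from in_L2_bound[OF _ _ this] show ?thesis using pos by simp
  qed
  show "in_L2 (\<lambda>x. f x + g x)"
    using *[of "L2_norm f + 1" "L2_norm g + 1"] by simp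
  show "L2_norm (\<lambda>x. f x + g x) \<le> L2_norm f + L2_norm g"
  proof (rule field_le_epsilon)
    fix e :: real assume "e > 0"
    then show "L2_norm (\<lambda>x. f x + g x) \<le> L2_norm f + L2_norm g + e"
      using *[of "L2_norm f + e / 2" "L2_norm g + e / 2"] by simp
  qed
qed

text \<open>One half of Plancherel's theorem, in the normalisation without constants in the transform.\<close>

lemma bessel_inequality:
  assumes "integrable lborel g" and "in_L2 g"
  shows "in_L2 (fourier_integral g)" and "L2_norm (fourier_integral g) \<le> sqrt (2 * pi) * L2_norm g"
proof -
  have m: "fourier_integral g \<in> borel_measurable lborel"
    using assms(1) measurable_fourier_integral[of g] by auto
  have n: "0 \<le> sqrt (2 * pi) * L2_norm g" by (simp add: L2_norm_nonneg)
  have "(\<integral>\<^sup>+x. ennreal ((norm (fourier_integral g x))\<^sup>2) \<partial>lborel) \<le> ennreal ((sqrt (2 * pi) * L2_norm g)\<^sup>2)"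
    using nn_bessel_inequality[OF assms(1)]
    by (simp add: in_L2_nn_integral[OF assms(2)] power_mult_distrib ennreal_mult')
  from in_L2_bound[OF m n this]
  show "in_L2 (fourier_integral g)" and "L2_norm (fourier_integral g) \<le> sqrt (2 * pi) * L2_norm g" .
qed

section \<open>Fourier transforms of Schwartz functions\<close>

lemma lborel_integrable_inverse_1_plus_square:
  "integrable lborel (\<lambda>x::real. inverse (1 + x\<^sup>2))"
  using integrable_inverse_1_plus_square by (simp add: set_integrable_def)

lemma schwartz_deriv: "schwartz v \<Longrightarrow> schwartz (deriv v)"
  unfolding schwartz_def funpow_swap1[symmetric] by (metis funpow.simps(2) comp_apply)

lemma schwartz_has_real_derivative:
  assumes "schwartz v"
  shows "(v has_real_derivative deriv v x) (at x)"
proof -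
  have "v differentiable_on UNIV"
    using assms unfolding schwartz_def by (metis funpow_0)
  then show ?thesis
    by (simp add: DERIV_deriv_iff_real_differentiable differentiable_on_def)
qed

lemma schwartz_isCont: "schwartz v \<Longrightarrow> isCont v x"
  using schwartz_has_real_derivative DERIV_isCont by blast

lemma schwartz_measurable:
  "schwartz v \<Longrightarrow> v \<in> borel_measurable borel"
  by (intro borel_measurable_continuous_onI continuous_at_imp_continuous_on ballI schwartz_isCont)

lemma schwartz_decay:
  assumes "schwartz v"
  obtains C where "\<And>x. \<bar>v x\<bar> \<le> C * inverse (1 + x\<^sup>2)" and "C \<ge> 0"
proof -
  have b: "bounded (range (\<lambda>x. x ^ m * v x))" for m
    using assms unfolding schwartz_def by (metis funpow_0)
  obtain C0 where C0: "\<bar>v x\<bar> \<le> C0" for x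
    using b[of 0] by (auto simp: bounded_iff)
  obtain C2 where C2: "\<bar>x\<^sup>2 * v x\<bar> \<le> C2" for x
    using b[of 2] by (auto simp: bounded_iff)
  show ?thesis
  proof
    fix x :: real
    have pos: "1 + x\<^sup>2 > 0" by (simp add: add_pos_nonneg)
    have "\<bar>v x\<bar> * (1 + x\<^sup>2) \<le> C0 + C2"
      using C0[of x] C2[of x] by (simp add: abs_mult algebra_simps)
    then show "\<bar>v x\<bar> \<le> (C0 + C2) * inverse (1 + x\<^sup>2)"
      using pos by (simp add: field_simps)
  next
    show "C0 + C2 \<ge> 0" using C0[of 0] C2[of 0] by linarith
  qed
qed

lemma schwartz_integrable:
  assumes "schwartz v"
  shows "integrable lborel v"
proof -
  obtain C where C: "\<And>x. \<bar>v x\<bar> \<le> C * inverse (1 + x\<^sup>2)" "C \<ge> 0"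
    using schwartz_decay[OF assms] by blast
  show ?thesis
  proof (rule Bochner_Integration.integrable_bound)
    show "integrable lborel (\<lambda>x. C * inverse (1 + x\<^sup>2))"
      using lborel_integrable_inverse_1_plus_square by simp
    show "AE x in lborel. norm (v x) \<le> norm (C * inverse (1 + x\<^sup>2))"
      using C by (auto intro: order.trans[OF _ abs_ge_self])
  qed (use schwartz_measurable[OF assms] in simp)
qed

lemma schwartz_in_L2:
  assumes "schwartz v"
  shows "in_L2 v"
proof -
  obtain C where C: "\<And>x. \<bar>v x\<bar> \<le> C * inverse (1 + x\<^sup>2)" "C \<ge> 0"
    using schwartz_decay[OF assms] by blast
  have bdd: "\<bar>v x\<bar> \<le> C" for x
  proof -
    have "C * inverse (1 + x\<^sup>2) \<le> C * 1"
      using C(2) by (intro mult_left_mono) (auto simp: inverse_le_1_iff)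
    with C(1)[of x] show ?thesis by simp
  qed
  have [measurable]: "v \<in> borel_measurable borel" by (rule schwartz_measurable[OF assms])
  have "integrable lborel (\<lambda>x. (norm (v x))\<^sup>2)"
  proof (rule Bochner_Integration.integrable_bound)
    show "integrable lborel (\<lambda>x. C * v x)"
      using schwartz_integrable[OF assms] by simp
    show "AE x in lborel. norm ((norm (v x))\<^sup>2) \<le> norm (C * v x)"
    proof (intro AE_I2)
      fix x
      show "norm ((norm (v x))\<^sup>2) \<le> norm (C * v x)"
        using mult_right_mono[OF bdd[of x], of "\<bar>v x\<bar>"] C(2) by (simp add: abs_mult power2_eq_square)
    qed
  qed measurable
  then show ?thesis by (simp add: in_L2_def)
qed

lemma schwartz_tendsto_0:
  assumes "schwartz v"
  shows "(v \<longlongrightarrow> 0) at_top" and "(v \<longlongrightarrow> 0) at_bot"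
proof -
  obtain C where C: "\<And>x. \<bar>v x\<bar> \<le> C * inverse (1 + x\<^sup>2)" "C \<ge> 0"
    using schwartz_decay[OF assms] by blast
  have "((\<lambda>x::real. C * inverse (1 + x\<^sup>2)) \<longlongrightarrow> 0) at_top" by real_asymp
  then show "(v \<longlongrightarrow> 0) at_top"
    by (rule Lim_null_comparison[rotated]) (use C in auto)
  have "((\<lambda>x::real. C * inverse (1 + x\<^sup>2)) \<longlongrightarrow> 0) at_bot" by real_asymp
  then show "(v \<longlongrightarrow> 0) at_bot"
    by (rule Lim_null_comparison[rotated]) (use C in auto)
qed

text \<open>Integration by parts: the derivative of \<open>e\<^sup>i\<^sup>x\<^sup>\<xi> * v x\<close> has integral zero because \<open>v\<close> vanishes at
  infinity.\<close>

lemma fourier_integral_deriv: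
  assumes v: "schwartz v"
  shows "fourier_integral (\<lambda>x. of_real (deriv v x)) \<xi>
           = - \<i> * of_real \<xi> * fourier_integral (\<lambda>x. of_real (v x)) \<xi>"
proof -
  let ?e = "\<lambda>x. iexp (\<xi> * x)"
  let ?F = "\<lambda>x. ?e x * of_real (v x)"
  let ?f = "\<lambda>x. \<i> * of_real \<xi> * (?e x * of_real (v x)) + ?e x * of_real (deriv v x)"
  have i0: "integrable lborel (\<lambda>x. ?e x * of_real (v x))"
    by (intro integrable_oscillation integrable_of_real schwartz_integrable v)
  have i1: "integrable lborel (\<lambda>x. ?e x * of_real (deriv v x))"
    by (intro integrable_oscillation integrable_of_real schwartz_integrable schwartz_deriv v)
  have lim: "(?F \<longlongrightarrow> 0) F" if "(v \<longlongrightarrow> 0) F" for F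
  proof (rule Lim_null_comparison)
    show "((\<lambda>x. norm (v x)) \<longlongrightarrow> 0) F" using that by (rule tendsto_norm_zero)
  qed (simp add: norm_mult)
  have "(LBINT x=-\<infinity>..\<infinity>. ?f x) = 0 - 0"
  proof (rule interval_integral_FTC_integrable)
    fix x :: real
    have e: "(?e has_vector_derivative \<i> * of_real \<xi> * ?e x) (at x)"
    proof -
      have "((iexp \<circ> (\<lambda>x. \<xi> * x)) has_vector_derivative \<xi> *\<^sub>R (\<i> * iexp (\<xi> * x))) (at x)"
        by (intro vector_diff_chain_at has_vector_derivative_iexp) (auto intro!: derivative_eq_intros)
      then show ?thesis by (simp add: o_def scaleR_conv_of_real mult_ac)
    qed
    show "(?F has_vector_derivative ?f x) (at x)"
      using has_vector_derivative_mult[OF e has_vector_derivative_of_real[OF schwartz_has_real_derivative[OF v]]]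
      by (simp add: algebra_simps)
    show "isCont ?f x"
      by (intro continuous_intros isCont_o2[OF schwartz_isCont[OF v]] schwartz_isCont v schwartz_deriv)
  next
    show "set_integrable lborel (einterval (- \<infinity>) \<infinity>) ?f"
      using i0 i1 by (simp add: set_integrable_def)
    show "((?F \<circ> real_of_ereal) \<longlongrightarrow> 0) (at_right (- \<infinity>))"
      using lim[OF schwartz_tendsto_0(2)[OF v]] unfolding ereal_tendsto_simps by simp
    show "((?F \<circ> real_of_ereal) \<longlongrightarrow> 0) (at_left \<infinity>)"
      using lim[OF schwartz_tendsto_0(1)[OF v]] unfolding ereal_tendsto_simps by simp
  qed simp
  also have "(LBINT x=-\<infinity>..\<infinity>. ?f x) = (LBINT x. ?f x)"
    by (simp add: interval_lebesgue_integral_def set_lebesgue_integral_def)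
  also have "\<dots> = \<i> * of_real \<xi> * fourier_integral (\<lambda>x. of_real (v x)) \<xi>
      + fourier_integral (\<lambda>x. of_real (deriv v x)) \<xi>"
    unfolding fourier_integral_def using i0 i1 by simp
  finally show ?thesis by (simp add: add_eq_0_iff2 add.commute)
qed

lemma fourier_conv_fourier_integral:
  "fourier v \<xi> = of_real (1 / (2 * pi)) * fourier_integral (\<lambda>x. of_real (v x)) \<xi>"
  by (simp add: fourier_def fourier_integral_def mult.commute)

text \<open>The factor \<open>1 / (2 * pi)\<close> in the transform turns Bessel's constant \<open>sqrt (2 * pi)\<close> into its
  reciprocal.\<close>

lemma L2_norm_fourier_le:
  assumes "schwartz v"
  shows "in_L2 (fourier v)" and "sqrt (2 * pi) * L2_norm (fourier v) \<le> L2_norm v"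
proof -
  let ?F = "fourier_integral (\<lambda>x. of_real (v x))"
  have [measurable]: "v \<in> borel_measurable borel" by (rule schwartz_measurable[OF assms])
  have v: "integrable lborel (\<lambda>x. complex_of_real (v x))"
    using schwartz_integrable[OF assms] by simp
  have v2: "in_L2 (\<lambda>x. complex_of_real (v x))"
    using schwartz_in_L2[OF assms] by (simp add: in_L2_def)
  note bessel = bessel_inequality[OF v v2]
  have eq: "fourier v = (\<lambda>\<xi>. of_real (1 / (2 * pi)) * ?F \<xi>)"
    by (intro ext fourier_conv_fourier_integral)
  show "in_L2 (fourier v)"
    unfolding eq by (rule L2_norm_cmult(1)[OF bessel(1)])
  have "L2_norm (fourier v) = 1 / (2 * pi) * L2_norm ?F"
    unfolding eq L2_norm_cmult(2)[OF bessel(1)] by (simp add: norm_divide norm_mult)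
  then have "sqrt (2 * pi) * L2_norm (fourier v) = L2_norm ?F / sqrt (2 * pi)"
    using real_sqrt_mult_self[of "2 * pi"] by (simp add: field_simps)
  also have "\<dots> \<le> L2_norm (\<lambda>x. complex_of_real (v x))"
    using bessel(2) by (simp add: divide_le_eq mult.commute)
  also have "\<dots> = L2_norm v" by (simp add: L2_norm_def)
  finally show "sqrt (2 * pi) * L2_norm (fourier v) \<le> L2_norm v" .
qed

text \<open>Bessel's inequality for \<open>v\<close> and for \<open>deriv v\<close> gives the integrability of
  \<open>(1 + \<xi>\<^sup>2) * |fourier v \<xi>|\<^sup>2\<close>. Since \<open>1 / (1 + \<xi>\<^sup>2)\<close> is integrable too, their geometric mean
  \<open>|fourier v \<xi>|\<close> is integrable.\<close>

lemma fourier_integrable: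
  assumes "schwartz v"
  shows "integrable lborel (fourier v)"
proof (rule Bochner_Integration.integrable_bound)
  have d: "fourier (deriv v) \<xi> = - \<i> * of_real \<xi> * fourier v \<xi>" for \<xi>
    by (simp add: fourier_conv_fourier_integral fourier_integral_deriv[OF assms])
  have "integrable lborel (\<lambda>\<xi>. (norm (fourier v \<xi>))\<^sup>2)"
    using L2_norm_fourier_le(1)[OF assms] by (simp add: in_L2_def)
  moreover have "integrable lborel (\<lambda>\<xi>. (norm (fourier (deriv v) \<xi>))\<^sup>2)"
    using L2_norm_fourier_le(1)[OF schwartz_deriv[OF assms]] by (simp add: in_L2_def)
  ultimately show "integrable lborel
      (\<lambda>\<xi>. (norm (fourier v \<xi>))\<^sup>2 + (norm (fourier (deriv v) \<xi>))\<^sup>2 + inverse (1 + \<xi>\<^sup>2))"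
    by (intro Bochner_Integration.integrable_add lborel_integrable_inverse_1_plus_square)
  show "fourier v \<in> borel_measurable lborel"
    using L2_norm_fourier_le(1)[OF assms] by (simp add: in_L2_def)
  show "AE \<xi> in lborel. norm (fourier v \<xi>)
      \<le> norm ((norm (fourier v \<xi>))\<^sup>2 + (norm (fourier (deriv v) \<xi>))\<^sup>2 + inverse (1 + \<xi>\<^sup>2))"
  proof (intro AE_I2)
    fix \<xi> :: real
    define y where "y = norm (fourier v \<xi>)"
    define q where "q = 1 + \<xi>\<^sup>2"
    have q: "q > 0" unfolding q_def by (simp add: add_pos_nonneg)
    have y: "y \<ge> 0" by (simp add: y_def)
    \<comment> \<open>The inequality between the geometric and the arithmetic mean of \<open>q * y\<^sup>2\<close> and \<open>1 / q\<close>.\<close>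
    have "2 * (q * y) \<le> (q * y)\<^sup>2 + 1"
      using sum_squares_bound[of "q * y" 1] by simp
    then have "q * y \<le> (q * y)\<^sup>2 + 1"
      using q y by (smt (verit) mult_nonneg_nonneg)
    also have "\<dots> = q * (q * y\<^sup>2 + inverse q)"
      using q by (simp add: field_simps power2_eq_square)
    finally have "y \<le> q * y\<^sup>2 + inverse q"
      using q by simp
    also have "q * y\<^sup>2 = (norm (fourier v \<xi>))\<^sup>2 + (norm (fourier (deriv v) \<xi>))\<^sup>2"
      by (simp add: d norm_mult q_def y_def power_mult_distrib algebra_simps)
    finally show "norm (fourier v \<xi>)
      \<le> norm ((norm (fourier v \<xi>))\<^sup>2 + (norm (fourier (deriv v) \<xi>))\<^sup>2 + inverse (1 + \<xi>\<^sup>2))"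
      unfolding y_def q_def by simp
  qed
qed

section \<open>The multipliers and the energy estimate\<close>

lemma dispersion_measurable [measurable]: "dispersion \<rho> \<kappa> \<delta> \<alpha> \<in> borel_measurable borel"
  unfolding dispersion_def set_lebesgue_integral_def by measurable

lemma dispersion_nonneg:
  assumes "\<rho> > 0" and "\<kappa> > 0"
  shows "dispersion \<rho> \<kappa> \<delta> \<alpha> \<xi> \<ge> 0"
  unfolding dispersion_def set_lebesgue_integral_def using assms
  by (intro real_sqrt_ge_zero mult_nonneg_nonneg Bochner_Integration.integral_nonneg) auto

text \<open>The two entries of the minimum are the two elementary bounds \<open>|sin (\<omega>t)| \<le> \<omega>t\<close> and
  \<open>|sin (\<omega>t)| \<le> 1\<close>.\<close>

lemma sin_quot_le_min_recip:
  assumes "t > 0" and "\<omega> \<ge> 0"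
  shows "\<bar>sin_quot t \<omega>\<bar> \<le> \<bar>min_recip t \<omega>\<bar>"
proof (cases "\<omega> = 0")
  case False
  then have "\<omega> > 0" using assms(2) by simp
  moreover have "\<bar>sin (\<omega> * t)\<bar> \<le> \<omega> * t"
    using abs_sin_x_le_abs_x[of "\<omega> * t"] assms by simp
  ultimately show ?thesis
    using assms False by (auto simp: sin_quot_def min_recip_def min_def field_simps)
qed (simp add: sin_quot_def min_recip_def)

lemma min_recip_le:
  assumes "t > 0" and "\<omega> \<ge> 0"
  shows "\<bar>min_recip t \<omega>\<bar> \<le> t"
  using assms by (auto simp: min_recip_def min_def)

theorem theorem3p3:
  fixes \<rho> \<kappa> \<delta> \<alpha> :: real
    and v0 v1 :: "real \<Rightarrow> real"
    and u :: "real \<Rightarrow> real \<Rightarrow> complex"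
    and \<omega> :: "real \<Rightarrow> real"
  assumes "\<rho> > 0" and "\<kappa> > 0" and "\<delta> > 0"
    and "0 < \<alpha>" and "\<alpha> < 1"
    and "schwartz v0" and "schwartz v1"
  defines "u \<equiv> nonlocal_wave_solution \<rho> \<kappa> \<delta> \<alpha> v0 v1"
    and "\<omega> \<equiv> dispersion \<rho> \<kappa> \<delta> \<alpha>"
  shows "\<forall>t>0.
    in_L2 (u t) \<and>
    in_L2 v0 \<and>
    in_L2 (\<lambda>\<xi>. fourier v1 \<xi> * of_real (min_recip t (\<omega> \<xi>))) \<and>
    L2_norm (u t) \<le>
      L2_norm v0 + sqrt (2 * pi) * L2_norm (\<lambda>\<xi>. fourier v1 \<xi> * of_real (min_recip t (\<omega> \<xi>)))"
proof (intro allI impI)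
  fix t :: real assume t: "t > 0"
  have [measurable]: "\<omega> \<in> borel_measurable borel"
    unfolding \<omega>_def by measurable
  have \<omega>: "\<omega> \<xi> \<ge> 0" for \<xi>
    unfolding \<omega>_def using assms by (intro dispersion_nonneg)
  have [measurable]: "(\<lambda>\<xi>. sin_quot t (\<omega> \<xi>)) \<in> borel_measurable borel"
    "(\<lambda>\<xi>. min_recip t (\<omega> \<xi>)) \<in> borel_measurable borel"
    unfolding sin_quot_def min_recip_def by measurable
  have [measurable]: "cnj \<in> borel_measurable borel"
    by (intro borel_measurable_continuous_onI linear_continuous_on bounded_linear_cnj)
  note f0 = L2_norm_fourier_le[OF \<open>schwartz v0\<close>] and f1 = L2_norm_fourier_le[OF \<open>schwartz v1\<close>]
  have [measurable]: "fourier v0 \<in> borel_measurable borel" "fourier v1 \<in> borel_measurable borel"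
    using f0(1) f1(1) by (simp_all add: in_L2_def)
  define m1 where "m1 \<xi> = fourier v1 \<xi> * of_real (min_recip t (\<omega> \<xi>))" for \<xi>
  define g0 where "g0 \<xi> = fourier v0 \<xi> * of_real (cos (\<omega> \<xi> * t))" for \<xi>
  define g1 where "g1 \<xi> = fourier v1 \<xi> * of_real (sin_quot t (\<omega> \<xi>))" for \<xi>
  have [measurable]: "m1 \<in> borel_measurable borel" "g0 \<in> borel_measurable borel" "g1 \<in> borel_measurable borel"
    unfolding m1_def g0_def g1_def by measurable

  have g0_le: "norm (g0 \<xi>) \<le> norm (fourier v0 \<xi>)" for \<xi>
    unfolding g0_def by (simp add: norm_mult mult_left_le)
  have g1_le: "norm (g1 \<xi>) \<le> norm (m1 \<xi>)" for \<xi>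
    unfolding g1_def m1_def using sin_quot_le_min_recip[OF t \<omega>[of \<xi>]]
    by (simp add: norm_mult mult_left_mono)
  have m1_le: "norm (m1 \<xi>) \<le> norm (of_real t * fourier v1 \<xi>)" for \<xi>
    unfolding m1_def using mult_left_mono[OF min_recip_le[OF t \<omega>[of \<xi>]], of "norm (fourier v1 \<xi>)"] t
    by (simp add: norm_mult mult.commute)

  have m1: "in_L2 m1"
    by (rule L2_norm_mono(1)[OF L2_norm_cmult(1)[OF f1(1)] _ m1_le]) measurable
  have g0: "in_L2 g0" "L2_norm g0 \<le> L2_norm (fourier v0)"
    by (rule L2_norm_mono[OF f0(1) _ g0_le]; measurable)+
  have g1: "in_L2 g1" "L2_norm g1 \<le> L2_norm m1"
    by (rule L2_norm_mono[OF m1 _ g1_le]; measurable)+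
  note g = L2_norm_triangle[OF g0(1) g1(1)]

  \<comment> \<open>The solution has the kernel \<open>e\<^sup>-\<^sup>i\<^sup>x\<^sup>\<xi>\<close>, so it is the conjugate of a Fourier integral.\<close>
  define h where "h \<xi> = cnj (g0 \<xi> + g1 \<xi>)" for \<xi>
  have h: "in_L2 h" "L2_norm h \<le> L2_norm (fourier v0) + L2_norm m1"
  proof -
    have [measurable]: "h \<in> borel_measurable borel" unfolding h_def by measurable
    have "norm (h \<xi>) \<le> norm (g0 \<xi> + g1 \<xi>)" for \<xi>
      unfolding h_def complex_mod_cnj by simp
    from L2_norm_mono[OF g(1) _ this]
    show "in_L2 h" "L2_norm h \<le> L2_norm (fourier v0) + L2_norm m1"
      using g(2) g0(2) g1(2) by simp_all
  qed
  have "integrable lborel h"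
  proof -
    have "integrable lborel g0"
      using g0_le by (intro Bochner_Integration.integrable_bound[OF fourier_integrable[OF \<open>schwartz v0\<close>]]) auto
    moreover have "integrable lborel g1"
      using order.trans[OF g1_le m1_le]
      by (intro Bochner_Integration.integrable_bound[OF
            integrable_mult_right[OF fourier_integrable[OF \<open>schwartz v1\<close>]]]) auto
    ultimately show ?thesis unfolding h_def by simp
  qed
  note bessel = bessel_inequality[OF this h(1)]
  have u: "u t x = cnj (fourier_integral h x)" for x
  proof -
    have "u t x = (LBINT \<xi>. cnj (iexp (x * \<xi>) * h \<xi>))"
      unfolding u_def nonlocal_wave_solution_def
      by (intro Bochner_Integration.integral_cong refl)
         (simp add: h_def g0_def g1_def \<omega>_def exp_cnj mult.commute)
    also have "\<dots> = cnj (fourier_integral h x)"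
      unfolding fourier_integral_def by (rule Bochner_Integration.integral_cnj)
    finally show ?thesis .
  qed
  have "in_L2 (u t)" and u_norm: "L2_norm (u t) = L2_norm (fourier_integral h)"
    using bessel(1) unfolding u[abs_def] by (auto simp: in_L2_def L2_norm_def)
  moreover have "L2_norm (u t) \<le> L2_norm v0 + sqrt (2 * pi) * L2_norm m1"
  proof -
    have "L2_norm (u t) \<le> sqrt (2 * pi) * L2_norm h"
      using bessel(2) u_norm by simp
    also have "\<dots> \<le> sqrt (2 * pi) * (L2_norm (fourier v0) + L2_norm m1)"
      using h(2) by (intro mult_left_mono) auto
    also have "\<dots> \<le> L2_norm v0 + sqrt (2 * pi) * L2_norm m1"
      using f0(2) by (simp add: distrib_left)
    finally show ?thesis .
  qed
  ultimately show "in_L2 (u t) \<and> in_L2 v0 \<and>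
    in_L2 (\<lambda>\<xi>. fourier v1 \<xi> * of_real (min_recip t (\<omega> \<xi>))) \<and>
    L2_norm (u t) \<le>
      L2_norm v0 + sqrt (2 * pi) * L2_norm (\<lambda>\<xi>. fourier v1 \<xi> * of_real (min_recip t (\<omega> \<xi>)))"
    using m1 schwartz_in_L2[OF \<open>schwartz v0\<close>] unfolding m1_def[abs_def] by blast
qed

end
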